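(* Let $q_0$ be a rational number such that neither $2+q_0$ nor $2-q_0$ is a rational square. Then for every $k=1,2,\dots$: $(\Omega_k^+\setminus\Omega_k^-)\cap R_{k-1}\subset \Pi_0(q_0)\cap\{p: 2^{k-1}\,\|\,\widehat p\}$; $(\Omega_k^-\setminus\Omega_k^+)\cap R_{k-1}\subset \Pi_1(q_0)\cap\{p: 2^{k-1}\,\|\,\widehat p\}$; $Z_k\subset \Pi_*(q_0)\cap\{p: 2^{k}\mid\widehat p\}$; and $R_k\subset\{p:2^k\mid\widehat p\}$.
   Context: Chebyshev polynomials: $U_0=0$, $U_1=1$, $U_{n+1}=qU_n-U_{n-1}$; $C_n=U_{n+1}-U_{n-1}$ (so $C_0=2$, $C_1=q$, $C_2=q^2-2$); for odd $n=2k+1$, $V_n=U_{k+1}-U_k$, $W_n=U_{k+1}+U_k$. For a rational $q$, congruences mod an odd prime $p$ not dividing the denominator of $q$ are taken in $\mathbb F_p$, and: $p\in\Pi_0(q)$ if $W_n(q)\equiv0$ for some odd $n\ge1$; $p\in\Pi_1(q)$ if $V_n(q)\equiv0$ for some odd $n\ge1$; $p\in\Pi_{2+k}(q)$ ($k\ge0$) if $C_{2^kn}(q)\equiv0$ for some odd $n\ge1$; $\Pi_*(q)=\bigcup_{k\ge2}\Pi_k(q)$. Legendre symbol of a rational $x=a/b$ (lowest terms) at an odd prime $p\nmid b$: $(x|p)=1$ if $ab$ is a nonzero square mod $p$, $-1$ if a nonsquare, $0$ if $p\mid a$. Let $\delta=q_0^2-4$, and let $\Pi'$ be the set of odd primes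 dividing neither the numerator nor the denominator of $\delta$; for $p\in\Pi'$ put $\widehat p=\frac{p-(\delta|p)}{2}$. All sets below are subsets of $\Pi'$. For $s\ge1$, $\Omega_s^{\pm}=\{p\in\Pi': C_{2^s}(a)\equiv\pm q_0 \bmod p \text{ for some } a\in\mathbb F_p\}$, and $\Omega_0^\pm=\Pi'$. $R_k=\Omega_k^+\cap\Omega_k^-$ (so $R_0=\Pi'$), $Z_k=R_{k-1}\setminus(\Omega_k^+\cup\Omega_k^-)$. $2^j\,\|\,m$ means $2^j\mid m$ and $2^{j+1}\nmid m$. *)

theory Defs
  imports "HOL-Number_Theory.Number_Theory"
begin

fun cheb_U :: "'a::comm_ring_1 \<Rightarrow> nat \<Rightarrow> 'a" where
  "cheb_U q 0 = 0"
| "cheb_U q (Suc 0) = 1"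
| "cheb_U q (Suc (Suc n)) = q * cheb_U q (Suc n) - cheb_U q n"

text \<open>
  \<open>C\<^sub>n = U\<^sub>n\<^sub>+\<^sub>1 - U\<^sub>n\<^sub>-\<^sub>1\<close>; the value at 0 comes from extending the
  recurrence backwards to \<open>U\<^sub>-\<^sub>1 = -1\<close>.
\<close>

fun cheb_C :: "'a::comm_ring_1 \<Rightarrow> nat \<Rightarrow> 'a" where
  "cheb_C q 0 = 2"
| "cheb_C q (Suc n) = cheb_U q (Suc (Suc n)) - cheb_U q n"

text \<open>
  The next two functions are meaningful only for odd \<open>n\<close>; with \<open>n = 2 k + 1\<close>
  one has \<open>n div 2 = k\<close>.
\<close>

definition cheb_V :: "'a::comm_ring_1 \<Rightarrow> nat \<Rightarrow> 'a" where
  "cheb_V q n = cheb_U q (n div 2 + 1) - cheb_U q (n div 2)"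

definition cheb_W :: "'a::comm_ring_1 \<Rightarrow> nat \<Rightarrow> 'a" where
  "cheb_W q n = cheb_U q (n div 2 + 1) + cheb_U q (n div 2)"

definition rat_numer :: "rat \<Rightarrow> int" where
  "rat_numer x = fst (quotient_of x)"

definition rat_denom :: "rat \<Rightarrow> int" where
  "rat_denom x = snd (quotient_of x)"

text \<open>
  Equality of the residues in the field with \<open>p\<close> elements of two rationals whose
  denominators are prime to \<open>p\<close>.
\<close>

definition rat_cong :: "nat \<Rightarrow> rat \<Rightarrow> rat \<Rightarrow> bool" where
  "rat_cong p x y \<longleftrightarrow>
     \<not> int p dvd rat_denom x \<and> \<not> int p dvd rat_denom y \<and> int p dvd rat_numer (x - y)"

definition odd_good_prime :: "rat \<Rightarrow> nat \<Rightarrow> bool" where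
  "odd_good_prime q p \<longleftrightarrow> prime p \<and> odd p \<and> \<not> int p dvd rat_denom q"

fun Pi_class :: "nat \<Rightarrow> rat \<Rightarrow> nat set" where
  "Pi_class 0 q =
     {p. odd_good_prime q p \<and> (\<exists>n. odd n \<and> rat_cong p (cheb_W q n) 0)}"
| "Pi_class (Suc 0) q =
     {p. odd_good_prime q p \<and> (\<exists>n. odd n \<and> rat_cong p (cheb_V q n) 0)}"
| "Pi_class (Suc (Suc k)) q =
     {p. odd_good_prime q p \<and> (\<exists>n. odd n \<and> rat_cong p (cheb_C q (2 ^ k * n)) 0)}"

definition Pi_star :: "rat \<Rightarrow> nat set" where
  "Pi_star q = (\<Union>k\<in>{2..}. Pi_class k q)"

text \<open>Only used when \<open>p\<close> is an odd prime not dividing the denominator of \<open>x\<close>.\<close>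

definition rat_Legendre :: "rat \<Rightarrow> nat \<Rightarrow> int" where
  "rat_Legendre x p = Legendre (rat_numer x * rat_denom x) (int p)"

definition disc :: "rat \<Rightarrow> rat" where
  "disc q0 = q0 ^ 2 - 4"

definition Pi_prime :: "rat \<Rightarrow> nat set" where
  "Pi_prime q0 = {p. prime p \<and> odd p \<and>
     \<not> int p dvd rat_numer (disc q0) \<and> \<not> int p dvd rat_denom (disc q0)}"

text \<open>
  For \<open>p \<in> Pi_prime q0\<close> the Legendre symbol is \<open>1\<close> or \<open>-1\<close> and \<open>p\<close> is odd, so the
  division is exact.
\<close>

definition p_hat :: "rat \<Rightarrow> nat \<Rightarrow> int" where
  "p_hat q0 p = (int p - rat_Legendre (disc q0) p) div 2"

definition exactly_divides :: "nat \<Rightarrow> int \<Rightarrow> bool" where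
  "exactly_divides j m \<longleftrightarrow> 2 ^ j dvd m \<and> \<not> 2 ^ (j + 1) dvd m"

text \<open>Elements of the field with \<open>p\<close> elements are given by integer representatives \<open>a\<close>.\<close>

definition Omega_plus :: "rat \<Rightarrow> nat \<Rightarrow> nat set" where
  "Omega_plus q0 s = (if s = 0 then Pi_prime q0
     else {p \<in> Pi_prime q0. \<exists>a::int. rat_cong p (of_int (cheb_C a (2 ^ s))) q0})"

definition Omega_minus :: "rat \<Rightarrow> nat \<Rightarrow> nat set" where
  "Omega_minus q0 s = (if s = 0 then Pi_prime q0
     else {p \<in> Pi_prime q0. \<exists>a::int. rat_cong p (of_int (cheb_C a (2 ^ s))) (- q0)})"

definition R_set :: "rat \<Rightarrow> nat \<Rightarrow> nat set" where
  "R_set q0 k = Omega_plus q0 k \<inter> Omega_minus q0 k"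

text \<open>Only used for \<open>k \<ge> 1\<close>.\<close>

definition Z_set :: "rat \<Rightarrow> nat \<Rightarrow> nat set" where
  "Z_set q0 k = R_set q0 (k - 1) - (Omega_plus q0 k \<union> Omega_minus q0 k)"

end

theory Submission
  imports Defs
begin

text \<open>
  Write \<open>q = \<lambda> + 1/\<lambda>\<close> with \<open>\<lambda>\<close> in the cyclic group \<open>G\<close> of order \<open>p - (\<delta>|p)\<close> (the group of units of
  the prime field or the norm-one group of its quadratic extension, according to the Legendre
  symbol of \<open>\<delta>\<close>). Membership in the sets \<open>\<Omega>\<^sub>s\<close> says that \<open>\<lambda>\<close> resp. \<open>-\<lambda>\<close> is a \<open>2\<^sup>s\<close>-th power in \<open>G\<close>,
  which is decided by the 2-part of its order. No field extension is needed: everything is phrased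
  in terms of the trace \<open>C\<^sub>n(a)\<close> of the \<open>n\<close>-th power of an element with trace \<open>a\<close>. Cyclicity of \<open>G\<close>
  is replaced by the congruence \<open>C\<^sub>m(a) \<equiv> 2 (a + 2 | p)\<close>, where \<open>2 m\<close> is the order of \<open>G\<close>: an element
  of trace \<open>a\<close> is a square in \<open>G\<close> iff \<open>a + 2\<close> is a square modulo \<open>p\<close>.
\<close>

section \<open>Polynomial identities for the Chebyshev sequences\<close>

lemma cheb_C_eq_U: "cheb_C q n = 2 * cheb_U q (Suc n) - q * cheb_U q n"
  by (cases n) (simp_all add: algebra_simps)

lemma cheb_C_rec: "cheb_C q (Suc (Suc n)) = q * cheb_C q (Suc n) - cheb_C q n"
  unfolding cheb_C_eq_U by (simp add: algebra_simps)

lemma cheb_C_1: "cheb_C q (Suc 0) = q"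
  by simp

lemma cheb_C_2: "cheb_C q 2 = q^2 - 2"
  by (simp only: numeral_2_eq_2 cheb_C_rec cheb_C_1 cheb_C.simps(1)) (simp add: numeral_2_eq_2)

text \<open>With q = \<lambda> + 1/\<lambda>, this is the norm of
  \<open>cheb_U q (Suc n) - \<lambda> * cheb_U q n\<close>, which is a power of \<lambda>; the
  recurrence preserves the quadratic form.\<close>

lemma cheb_U_norm: "cheb_U q (Suc n) ^ 2 - q * cheb_U q (Suc n) * cheb_U q n + cheb_U q n ^ 2 = 1"
proof (induction n)
  case (Suc n)
  have "cheb_U q (Suc (Suc n)) ^ 2 - q * cheb_U q (Suc (Suc n)) * cheb_U q (Suc n) + cheb_U q (Suc n) ^ 2
     = cheb_U q (Suc n) ^ 2 - q * cheb_U q (Suc n) * cheb_U q n + cheb_U q n ^ 2"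
    by (simp add: algebra_simps power2_eq_square)
  with Suc show ?case by simp
qed simp

text \<open>In terms of x = \<lambda>^n this is (x + 1/x)^2 - 4 = (x - 1/x)^2.\<close>

lemma cheb_C_square: "cheb_C q n ^ 2 - 4 = (q^2 - 4) * cheb_U q n ^ 2"
proof -
  have "cheb_C q n ^ 2 - 4 = 4 * (cheb_U q (Suc n) ^ 2 - q * cheb_U q (Suc n) * cheb_U q n
      + cheb_U q n ^ 2) + (q^2 - 4) * cheb_U q n ^ 2 - 4"
    unfolding cheb_C_eq_U by (simp add: algebra_simps power2_eq_square)
  then show ?thesis unfolding cheb_U_norm by simp
qed

lemma cheb_C_mult_linear_recurrence:
  assumes rec: "\<And>n. f (Suc (Suc n)) = q * f (Suc n) - f n"
  shows "f (n + 2 * m) + f n = cheb_C q m * f (n + m)"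
proof (induction m arbitrary: n rule: induct_nat_012[case_names 0 1 step])
  case (step m)
  have "cheb_C q (Suc (Suc m)) * f (n + Suc (Suc m))
      = q * (cheb_C q (Suc m) * f (Suc n + Suc m)) - cheb_C q m * f (Suc (Suc n) + m)"
    unfolding cheb_C_rec by (simp add: algebra_simps)
  also have "\<dots> = q * (f (Suc n + 2 * Suc m) + f (Suc n)) - (f (Suc (Suc n) + 2 * m) + f (Suc (Suc n)))"
    using step by metis
  also have "\<dots> = f (n + 2 * Suc (Suc m)) + f n"
    by (simp add: rec algebra_simps)
  finally show ?case by simp
qed (simp_all add: rec)

text \<open>\<open>cheb_C q n\<close> is the trace of \<lambda>^n, and exponents of iterated powers
  multiply.\<close>

lemma cheb_C_mult: "cheb_C q (m * n) = cheb_C (cheb_C q n) m"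
proof (induction m rule: induct_nat_012[case_names 0 1 step])
  case (step m)
  have "cheb_C q (m * n + 2 * n) + cheb_C q (m * n) = cheb_C q n * cheb_C q (m * n + n)"
    by (rule cheb_C_mult_linear_recurrence) (rule cheb_C_rec)
  then have "cheb_C q (Suc (Suc m) * n) = cheb_C q n * cheb_C q (Suc m * n) - cheb_C q (m * n)"
    by (simp add: eq_diff_eq) (simp add: ac_simps mult_2_right flip: add.assoc)
  also have "\<dots> = cheb_C (cheb_C q n) (Suc (Suc m))"
    unfolding step cheb_C_rec ..
  finally show ?case .
qed simp_all

lemma cheb_C_double: "cheb_C q (2 * n) = cheb_C q n ^ 2 - 2"
  by (simp add: cheb_C_mult cheb_C_2)

lemma cheb_C_at_2: "cheb_C (2::'a::comm_ring_1) n = 2"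
  by (induction n rule: induct_nat_012) (simp_all add: cheb_C_rec del: cheb_C.simps(2), simp)

lemma cheb_U_minus: "cheb_U (- q) n = - ((-1) ^ n * cheb_U q n)"
  by (induction n rule: induct_nat_012) (simp_all add: algebra_simps)

lemma cheb_C_minus: "cheb_C (- q) n = (-1) ^ n * cheb_C q n"
  by (simp add: cheb_C_eq_U cheb_U_minus algebra_simps)

lemma cheb_V_minus: "cheb_V (- q) (2 * r + 1) = (-1) ^ r * cheb_W q (2 * r + 1)"
  by (simp add: cheb_V_def cheb_W_def cheb_U_minus algebra_simps)

lemma cheb_C_odd:
  "cheb_C q (2 * k + 1) = (2 * cheb_U q (Suc k) - q * cheb_U q k) * (q * cheb_U q (Suc k) - 2 * cheb_U q k) - q"
proof -
  have "cheb_C q (1 + 2 * k) + cheb_C q 1 = cheb_C q k * cheb_C q (1 + k)"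
    by (rule cheb_C_mult_linear_recurrence) (rule cheb_C_rec)
  moreover have "cheb_C q (1 + k) = q * cheb_U q (Suc k) - 2 * cheb_U q k"
    by (simp add: cheb_C_eq_U algebra_simps del: cheb_C.simps)
  ultimately show ?thesis
    by (simp add: cheb_C_eq_U algebra_simps del: cheb_C.simps)
qed

text \<open>Writing \<lambda> = \<mu>^2, both sides are (\<mu>^n - \<mu>^(-n))^2, because
  \<open>cheb_W q n\<close> is (\<mu>^n - \<mu>^(-n)) / (\<mu> - 1/\<mu>) for odd n.\<close>

lemma cheb_C_odd_minus_2:
  assumes "odd n"
  shows "cheb_C q n - 2 = (q - 2) * cheb_W q n ^ 2"
proof -
  from assms obtain k where n: "n = 2 * k + 1" by (rule oddE)
  let ?u = "cheb_U q k" and ?v = "cheb_U q (Suc k)"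
  have norm: "1 = ?v ^ 2 - q * ?v * ?u + ?u ^ 2"
    by (simp only: cheb_U_norm)
  \<comment> \<open>The factor 1 is kept so that \<open>norm\<close> can replace it by a quadratic
    form in \<open>?u\<close> and \<open>?v\<close>.\<close>
  have "cheb_C q n - 2 = (2 * ?v - q * ?u) * (q * ?v - 2 * ?u) - (q + 2) * 1"
    unfolding n cheb_C_odd by simp
  also have "\<dots> = (q - 2) * (?v + ?u) ^ 2"
    unfolding norm by (simp add: algebra_simps power2_eq_square)
  finally show ?thesis
    by (simp add: n cheb_W_def del: cheb_C.simps cheb_U.simps)
qed

section \<open>Congruences for \<open>cheb_V\<close> and \<open>cheb_W\<close> at a prime
  index\<close>

text \<open>Pascal's rule for the shift E of sequences: (1 + E)^(n+1) = (1 + E)^n + E (1 +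
  E)^n.\<close>

lemma binomial_sum_Suc:
  fixes f :: "nat \<Rightarrow> 'a::comm_ring_1"
  shows "(\<Sum>k\<le>Suc n. of_nat (Suc n choose k) * f (j + k))
       = (\<Sum>k\<le>n. of_nat (n choose k) * f (j + k)) + (\<Sum>k\<le>n. of_nat (n choose k) * f (Suc j + k))"
proof -
  have "(\<Sum>k\<le>Suc n. of_nat (Suc n choose k) * f (j + k))
      = f j + (\<Sum>k\<le>n. of_nat (n choose Suc k) * f (Suc j + k)) + (\<Sum>k\<le>n. of_nat (n choose k) * f (Suc j + k))"
    by (simp add: sum.atMost_Suc_shift sum.distrib algebra_simps del: sum.atMost_Suc)
  moreover have "(\<Sum>k\<le>n. of_nat (n choose k) * f (j + k)) = (\<Sum>k\<le>Suc n. of_nat (n choose k) * f (j + k))"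
    by (simp add: binomial_eq_0)
  moreover have "\<dots> = f j + (\<Sum>k\<le>n. of_nat (n choose Suc k) * f (Suc j + k))"
    by (subst sum.atMost_Suc_shift) simp
  ultimately show ?thesis by (simp only: add.assoc)
qed

text \<open>The recurrence says E^2 = a E - 1 for the shift E, so (1 + E)^2 = (a + 2) E.\<close>

lemma binomial_sum_linear_recurrence:
  fixes f :: "nat \<Rightarrow> 'a::comm_ring_1"
  assumes rec: "\<And>n. f (Suc (Suc n)) = a * f (Suc n) - f n"
  shows "(\<Sum>k\<le>2 * r. of_nat (2 * r choose k) * f (j + k)) = (a + 2) ^ r * f (j + r)"
proof (induction r arbitrary: j)
  case (Suc r)
  have "(\<Sum>k\<le>Suc (Suc (2 * r)). of_nat (Suc (Suc (2 * r)) choose k) * f (j + k))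
      = (a + 2) ^ r * (f (j + r) + 2 * f (Suc j + r) + f (Suc (Suc j) + r))"
    by (simp only: binomial_sum_Suc Suc) (simp add: algebra_simps)
  then show ?case by (simp add: rec algebra_simps)
qed simp

text \<open>
  With \<open>a = t\<^sup>2 + 1/t\<^sup>2\<close> this is \<open>(t + 1/t)\<^sup>p \<equiv> t\<^sup>p + 1/t\<^sup>p\<close> divided by \<open>t + 1/t\<close>. The binomial expansion is
  run along \<open>V\<^sub>2\<^sub>j\<^sub>+\<^sub>1\<close>, continued symmetrically to negative \<open>j\<close> and shifted by \<open>r + 1\<close>.
\<close>

lemma cheb_V_prime_cong:
  fixes a :: int
  assumes p: "prime p" "p = 2 * r + 1"
  shows "[cheb_V a p = (a + 2) ^ r] (mod int p)"
proof -
  define v where "v = (\<lambda>j. cheb_U a (Suc j) - cheb_U a j)"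
  define f where "f = (\<lambda>i. if i \<le> r then v (r - i) else v (i - r - 1))"
  have v_rec: "v (Suc (Suc n)) = a * v (Suc n) - v n" for n
    by (simp add: v_def algebra_simps)
  have v01: "v 0 = 1" "v (Suc 0) = a - 1"
    by (simp_all add: v_def)
  have f_rec: "f (Suc (Suc n)) = a * f (Suc n) - f n" for n
  proof -
    \<comment> \<open>The values run \<open>v 1\<close>, \<open>v 0\<close>, \<open>v 0\<close>,
      \<open>v 1\<close> around the centre between r and r + 1. In \<open>eq1\<close> and
      \<open>eq2\<close> the three indices straddle it, and \<open>v01\<close> gives the
      recurrence.\<close>
    consider (lt) d where "r = Suc (Suc (n + d))" | (eq1) "r = Suc n" | (eq2) "r = n"
      | (gt) d where "n = Suc (r + d)"
      by (metis less_iff_Suc_add linorder_neqE_nat add_Suc_right add.right_neutral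
          add_Suc nat.exhaust)
    then show ?thesis
    proof cases
      case lt
      then have "r - n = Suc (Suc d)" "r - Suc n = Suc d" "r - Suc (Suc n) = d" by auto
      then show ?thesis using lt by (simp add: f_def v_rec)
    next
      case gt
      then show ?thesis by (simp add: f_def v_rec Suc_diff_le)
    qed (simp_all add: f_def v01)
  qed
  \<comment> \<open>The odd row 2 r + 1 splits into two even rows, centred at the two middle entries
    of \<open>f\<close>.\<close>
  have "(\<Sum>k\<le>Suc (2 * r). int (Suc (2 * r) choose k) * f (0 + k)) = (a + 2) ^ r * (f r + f (Suc r))"
    by (simp only: binomial_sum_Suc binomial_sum_linear_recurrence[of f a, OF f_rec])
       (simp add: algebra_simps)
  also have "\<dots> = 2 * (a + 2) ^ r"
    by (simp add: f_def v01)
  finally have 1: "(\<Sum>k\<le>p. int (p choose k) * f k) = 2 * (a + 2) ^ r"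
    by (simp add: p(2) del: sum.atMost_Suc)
  have "(\<Sum>k\<le>p. int (p choose k) * f k) = f 0 + f p + (\<Sum>k\<in>{0<..<p}. int (p choose k) * f k)"
  proof -
    have "{..p} = insert 0 (insert p {0<..<p})" using p(2) by auto
    then show ?thesis using p(2) by simp
  qed
  \<comment> \<open>Only the two ends of the row survive modulo p, and they carry the same value by
    symmetry.\<close>
  moreover have "int p dvd (\<Sum>k\<in>{0<..<p}. int (p choose k) * f k)"
    by (intro dvd_sum dvd_mult2) (use p(1) in \<open>auto intro!: dvd_choose_prime\<close>)
  ultimately have "[2 * (a + 2) ^ r = f 0 + f p] (mod int p)"
    unfolding 1 by (simp add: cong_iff_dvd_diff)
  also have "f 0 + f p = 2 * cheb_V a p"
    by (simp add: f_def v_def cheb_V_def p(2))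
  finally have "[2 * cheb_V a p = 2 * (a + 2) ^ r] (mod int p)"
    by (rule cong_sym)
  moreover have "coprime 2 (int p)" using p(2) by simp
  ultimately show ?thesis by (simp add: cong_mult_lcancel)
qed

lemma cheb_W_prime_cong:
  fixes a :: int
  assumes p: "prime p" "p = 2 * r + 1"
  shows "[cheb_W a p = (a - 2) ^ r] (mod int p)"
proof -
  have "[(-1) ^ r * cheb_W a p = (-1) ^ r * (a - 2) ^ r] (mod int p)"
    using cheb_V_prime_cong[OF p, of "- a"]
    by (simp only: p(2) cheb_V_minus power_mult_distrib[symmetric]) simp
  moreover have "coprime ((-1) ^ r) (int p)"
    by (simp add: is_unit_left_imp_coprime)
  ultimately show ?thesis by (simp add: cong_mult_lcancel)
qed

section \<open>Reduction modulo p and the Legendre symbol\<close>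

lemma cheb_U_cong: "[a = b] (mod m) \<Longrightarrow> [cheb_U a n = cheb_U b n] (mod m)" for a b m :: int
  by (induction n rule: induct_nat_012) (auto intro!: cong_diff cong_mult)

lemma cheb_C_cong: "[a = b] (mod m) \<Longrightarrow> [cheb_C a n = cheb_C b n] (mod m)" for a b m :: int
  unfolding cheb_C_eq_U by (intro cong_diff cong_mult cheb_U_cong cong_refl)

lemma Legendre_cong: "[a = b] (mod p) \<Longrightarrow> Legendre a p = Legendre b p"
  by (simp add: Legendre_def QuadRes_def cong_def)

lemma Legendre_mult_square:
  fixes a c :: int
  assumes p: "prime p" "odd p" and c: "\<not> int p dvd c"
  shows "Legendre (a * c ^ 2) (int p) = Legendre a (int p)"
proof -
  have "coprime c (int p)"
    using p c by (metis coprime_commute prime_imp_coprime prime_nat_int_transfer)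
  then obtain d where d: "[c * d = 1] (mod int p)"
    using cong_solve_coprime_int by blast
  have zero: "[a * c ^ 2 = 0] (mod int p) \<longleftrightarrow> [a = 0] (mod int p)"
    using p c by (auto simp: cong_0_iff prime_dvd_mult_iff prime_dvd_power_iff)
  have "QuadRes (int p) (a * c ^ 2)" if "QuadRes (int p) a"
  proof -
    from that obtain y where "[y ^ 2 = a] (mod int p)" by (auto simp: QuadRes_def)
    then have "[(y * c) ^ 2 = a * c ^ 2] (mod int p)"
      by (simp add: power_mult_distrib cong_mult)
    then show ?thesis unfolding QuadRes_def by blast
  qed
  moreover have "QuadRes (int p) a" if "QuadRes (int p) (a * c ^ 2)"
  proof -
    from that obtain y where y: "[y ^ 2 = a * c ^ 2] (mod int p)" by (auto simp: QuadRes_def)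
    have "[y ^ 2 * d ^ 2 = a * c ^ 2 * d ^ 2] (mod int p)"
      by (intro cong_mult y cong_refl)
    moreover have "[a * (c * d) ^ 2 = a * 1 ^ 2] (mod int p)"
      by (intro cong_mult cong_pow d cong_refl)
    ultimately have "[(y * d) ^ 2 = a] (mod int p)"
      by (metis cong_trans mult.assoc mult.right_neutral one_power2 power_mult_distrib)
    then show ?thesis unfolding QuadRes_def by blast
  qed
  ultimately show ?thesis using zero by (auto simp: Legendre_def)
qed

text \<open>Half the order of the group containing \<lambda> when a = \<lambda> + 1/\<lambda> and p
  does not divide \<open>a ^ 2 - 4\<close>; the integer counterpart of \<open>p_hat\<close>.\<close>

definition half_order :: "nat \<Rightarrow> int \<Rightarrow> nat" where
  "half_order p a = nat ((int p - Legendre (a ^ 2 - 4) (int p)) div 2)"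

lemma half_order_minus: "half_order p (- a) = half_order p a"
  by (simp add: half_order_def)

section \<open>Powers and roots in the group, expressed by traces\<close>

context
  fixes p :: nat
  assumes prime: "prime p" and odd: "odd p"
begin

lemma not_dvd_two_power: "\<not> int p dvd 2 ^ n"
proof
  assume "int p dvd 2 ^ n"
  then have "p dvd 2 ^ n"
    by (metis int_dvd_int_iff of_nat_numeral of_nat_power)
  then have "p dvd 2" using prime prime_dvd_power_nat by blast
  then show False using prime odd by (metis primes_dvd_imp_eq two_is_prime_nat dvd_refl)
qed

lemma prime_int: "prime (int p)"
  using prime by simp

lemma half_order_pos: "half_order p a > 0"
proof -
  have "p > 2" using prime odd prime_gt_1_nat[of p] by (cases "p = 2") auto
  then show ?thesis by (auto simp: half_order_def Legendre_def)
qed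

text \<open>By Euler's criterion \<open>cheb_V a p\<close> and \<open>cheb_W a p\<close> are
  congruent to the Legendre symbols of a + 2 and a - 2, and twice the value of \<open>cheb_C\<close>
  at the half order is a combination of the two.\<close>

lemma cheb_C_half_order:
  assumes nd: "\<not> int p dvd a ^ 2 - 4"
  shows "[cheb_C a (half_order p a) = 2 * Legendre (a + 2) (int p)] (mod int p)"
proof -
  from odd obtain r where r: "p = 2 * r + 1" by (rule oddE)
  have p2: "2 < int p" using prime odd prime_gt_1_nat[of p] by (cases "p = 2") auto
  have euler: "[b ^ r = Legendre b (int p)] (mod int p)" for b
    using euler_criterion[OF prime, of b] p2 r by (auto intro: cong_sym)
  have fact: "a ^ 2 - 4 = (a + 2) * (a - 2)"
    by (simp add: algebra_simps power2_eq_square)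
  define e l where "e = Legendre (a ^ 2 - 4) (int p)" and "l = Legendre (a + 2) (int p)"
  have nd': "\<not> int p dvd a + 2" "\<not> int p dvd a - 2"
    using nd unfolding fact by auto
  have Leg: "Legendre b (int p) = 1 \<or> Legendre b (int p) = - 1" if "\<not> int p dvd b" for b
    using that by (auto simp: Legendre_def cong_0_iff)
  have "[e = l * Legendre (a - 2) (int p)] (mod int p)"
  proof -
    have "[(a + 2) ^ r * (a - 2) ^ r = l * Legendre (a - 2) (int p)] (mod int p)"
      unfolding l_def by (intro cong_mult euler)
    moreover have "[(a + 2) ^ r * (a - 2) ^ r = e] (mod int p)"
      unfolding e_def using euler[of "a ^ 2 - 4"] by (simp add: fact power_mult_distrib)
    ultimately show ?thesis by (metis cong_sym cong_trans)
  qed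
  \<comment> \<open>The symbols are 1 or -1 and p > 2, so a congruence between them is an
    equality.\<close>
  moreover have neq: "\<not> [1 = - 1] (mod int p)" "\<not> [- 1 = 1] (mod int p)"
    using p2 zdvd_imp_le[of "int p" 2] by (auto simp: cong_iff_dvd_diff)
  ultimately have "e = l * Legendre (a - 2) (int p)"
    using Leg[OF nd] Leg[OF nd'(1)] Leg[OF nd'(2)] by (auto simp: e_def l_def)
  moreover have e: "e = 1 \<or> e = - 1" and l: "l = 1 \<or> l = - 1"
    using Leg nd nd' by (auto simp: e_def l_def)
  ultimately have le: "Legendre (a - 2) (int p) = l * e"
    using Leg[OF nd'(2)] by auto
  have V: "[cheb_V a p = l] (mod int p)"
    using cheb_V_prime_cong[OF prime r] euler cong_trans l_def by blast
  have W: "[cheb_W a p = l * e] (mod int p)"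
    using cheb_W_prime_cong[OF prime r] euler cong_trans le by metis
  have "2 * cheb_C a (half_order p a) = (a + 2) * cheb_V a p - e * ((a - 2) * cheb_W a p)"
  proof (cases "e = 1")
    case True
    then have "half_order p a = r" using r by (simp add: half_order_def e_def)
    then show ?thesis using True
      by (simp add: r cheb_V_def cheb_W_def cheb_C_eq_U algebra_simps)
  next
    case False
    with e have e: "e = - 1" by simp
    then have "half_order p a = Suc r" using r by (simp add: half_order_def e_def)
    then show ?thesis using e
      by (simp add: r cheb_V_def cheb_W_def cheb_C_eq_U algebra_simps)
  qed
  moreover have "[(a + 2) * cheb_V a p - e * ((a - 2) * cheb_W a p)
      = (a + 2) * l - e * ((a - 2) * (l * e))] (mod int p)"
    by (intro cong_diff cong_mult cong_refl V W)
  moreover have "(a + 2) * l - e * ((a - 2) * (l * e)) = 2 * (2 * l)"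
    using e by (auto simp: algebra_simps)
  ultimately have "[2 * cheb_C a (half_order p a) = 2 * (2 * l)] (mod int p)"
    by simp
  moreover have "coprime 2 (int p)" using odd by simp
  ultimately show ?thesis unfolding l_def using cong_mult_lcancel by blast
qed

text \<open>The analogue of Lagrange's theorem: doubling the index turns the values 2 and -2 into 2,
  a fixed point of all further powers.\<close>

lemma cheb_C_order:
  assumes "\<not> int p dvd a ^ 2 - 4" "2 * half_order p a dvd n"
  shows "[cheb_C a n = 2] (mod int p)"
proof -
  from assms(2) obtain c where n: "n = c * (2 * half_order p a)"
    by (metis dvdE mult.commute)
  have "\<not> int p dvd a + 2"
    using assms(1) dvd_mult2[of "int p" "a + 2" "a - 2"]
    by (auto simp: algebra_simps power2_eq_square)
  then have "Legendre (a + 2) (int p) ^ 2 = 1"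
    by (auto simp: Legendre_def cong_0_iff)
  then have "[cheb_C a (2 * half_order p a) = 2] (mod int p)"
    using cong_diff[OF cong_pow[OF cheb_C_half_order[OF assms(1)], of 2] cong_refl[of 2]]
    by (simp add: cheb_C_double power_mult_distrib)
  then have "[cheb_C a n = cheb_C 2 c] (mod int p)"
    unfolding n cheb_C_mult[of a c] by (rule cheb_C_cong)
  then show ?thesis by (simp add: cheb_C_at_2)
qed

text \<open>The discriminants of a and \<open>cheb_C a n\<close> differ by a square factor, so a
  preimage of x belongs to the same group as x.\<close>

lemma half_order_cheb_C:
  assumes "[cheb_C a n = x] (mod int p)" "\<not> int p dvd x ^ 2 - 4"
  shows "\<not> int p dvd a ^ 2 - 4" "half_order p a = half_order p x"
proof -
  have "[cheb_C a n ^ 2 - 4 = x ^ 2 - 4] (mod int p)"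
    by (intro cong_diff cong_pow assms cong_refl)
  then have c: "[(a ^ 2 - 4) * cheb_U a n ^ 2 = x ^ 2 - 4] (mod int p)"
    by (simp add: cheb_C_square)
  then have nd: "\<not> int p dvd (a ^ 2 - 4) * cheb_U a n ^ 2"
    using assms(2) cong_dvd_iff by blast
  then show "\<not> int p dvd a ^ 2 - 4" by auto
  from nd have "\<not> int p dvd cheb_U a n" by (auto simp: power2_eq_square)
  then have "Legendre (a ^ 2 - 4) (int p) = Legendre (x ^ 2 - 4) (int p)"
    using Legendre_mult_square[OF prime odd] Legendre_cong[OF c] by metis
  then show "half_order p a = half_order p x" by (simp add: half_order_def)
qed

text \<open>If \<lambda> = \<mu>^s, then \<lambda>^m = \<mu>^(m s), which is 1 when the group order
  divides m s.\<close>

lemma cheb_C_eq_2_if_image: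
  assumes "[cheb_C a s = x] (mod int p)" "\<not> int p dvd x ^ 2 - 4" "2 * half_order p x dvd m * s"
  shows "[cheb_C x m = 2] (mod int p)"
proof -
  note a = half_order_cheb_C[OF assms(1,2)]
  have "[cheb_C x m = cheb_C (cheb_C a s) m] (mod int p)"
    by (intro cheb_C_cong cong_sym[OF assms(1)])
  also have "cheb_C (cheb_C a s) m = cheb_C a (m * s)"
    by (simp add: cheb_C_mult)
  also have "[cheb_C a (m * s) = 2] (mod int p)"
    using a assms(3) by (intro cheb_C_order) auto
  finally show ?thesis .
qed

text \<open>Square roots are extracted one at a time: for s > 0 the value at the half order is 2, so
  x + 2 is a square c^2 modulo p and c is the trace of a root. The root is annihilated by 2 m, and
  the half order is unchanged.\<close>

lemma image_if_cheb_C_eq_2: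
  assumes "2 * half_order p x = 2 ^ s * m" "[cheb_C x m = 2] (mod int p)" "\<not> int p dvd x ^ 2 - 4"
  shows "\<exists>a. [cheb_C a (2 ^ s) = x] (mod int p)"
  using assms
proof (induction s arbitrary: x m)
  case 0
  then show ?case by (auto intro!: exI[of _ x])
next
  case (Suc s)
  have h: "half_order p x = 2 ^ s * m" using Suc.prems(1) by simp
  have "[cheb_C x (2 ^ s * m) = cheb_C 2 (2 ^ s)] (mod int p)"
    unfolding cheb_C_mult[of x "2 ^ s" m] by (rule cheb_C_cong) (rule Suc.prems)
  then have "[2 = cheb_C x (half_order p x)] (mod int p)"
    unfolding h cheb_C_at_2 by (rule cong_sym)
  also have "[cheb_C x (half_order p x) = 2 * Legendre (x + 2) (int p)] (mod int p)"
    by (rule cheb_C_half_order) (rule Suc.prems)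
  finally have "int p dvd 2 - 2 * Legendre (x + 2) (int p)"
    by (simp add: cong_iff_dvd_diff)
  \<comment> \<open>The symbol 0 would give p dvd 2, and the symbol -1 would give p dvd 4.\<close>
  then have "QuadRes (int p) (x + 2)"
    using not_dvd_two_power[of 1] not_dvd_two_power[of 2]
    by (auto simp: Legendre_def QuadRes_def split: if_splits)
  then obtain c where "[c ^ 2 = x + 2] (mod int p)" by (auto simp: QuadRes_def)
  then have c: "[cheb_C c 2 = x] (mod int p)"
    unfolding cheb_C_2 by (auto simp: cong_iff_dvd_diff algebra_simps)
  note cx = half_order_cheb_C[OF c Suc.prems(3)]
  have "[cheb_C c (m * 2) = cheb_C x m] (mod int p)"
    unfolding cheb_C_mult[of c m] by (rule cheb_C_cong) (rule c)
  then have "[cheb_C c (m * 2) = 2] (mod int p)"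
    using Suc.prems(2) cong_trans by blast
  then obtain a where "[cheb_C a (2 ^ s) = c] (mod int p)"
    using Suc.IH[of c "m * 2"] Suc.prems(1) cx by auto
  then have "[cheb_C (cheb_C a (2 ^ s)) 2 = cheb_C c 2] (mod int p)"
    by (rule cheb_C_cong)
  then have "[cheb_C a (2 ^ Suc s) = x] (mod int p)"
    using c cong_trans by (fastforce simp: cheb_C_mult)
  then show ?case by blast
qed

text \<open>If \<lambda>^m = 1 with m = 2 n + 1, then \<lambda>^(n+1) is a square root of \<lambda>
  that is again annihilated by m, so the step repeats for every s.\<close>

lemma image_if_cheb_C_odd_eq_2:
  assumes "odd m" "[cheb_C x m = 2] (mod int p)" "\<not> int p dvd x ^ 2 - 4"
  shows "\<exists>a. [cheb_C a (2 ^ s) = x] (mod int p)"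
  using assms(2-)
proof (induction s arbitrary: x)
  case 0
  then show ?case by (auto intro!: exI[of _ x])
next
  case (Suc s)
  from assms(1) obtain n where n: "m = 2 * n + 1" by (rule oddE)
  define b where "b = cheb_C x (Suc n)"
  have "[cheb_C x m ^ 2 - 4 = 2 ^ 2 - 4] (mod int p)"
    by (intro cong_diff cong_pow Suc.prems cong_refl)
  then have "int p dvd (x ^ 2 - 4) * cheb_U x m ^ 2"
    by (simp add: cheb_C_square cong_0_iff)
  then have U: "int p dvd cheb_U x m"
    using Suc.prems(2) prime_int prime_dvd_mult_iff prime_dvd_power by blast
  \<comment> \<open>The values 2 of \<open>cheb_C\<close> and 0 of \<open>cheb_U\<close> at m
    together say \<lambda>^m = 1, so the trace of \<lambda>^(m+1) is x.\<close>
  have "2 * (cheb_C x (Suc m) - x) = x * (cheb_C x m - 2) + (x ^ 2 - 4) * cheb_U x m"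
    by (simp add: cheb_C_eq_U algebra_simps power2_eq_square del: cheb_C.simps)
  moreover have "int p dvd \<dots>"
    using Suc.prems(1) U by (auto simp: cong_iff_dvd_diff)
  ultimately have "int p dvd cheb_C x (Suc m) - x"
    using not_dvd_two_power[of 1] prime_int by (metis power_one_right prime_dvd_mult_iff)
  moreover have "cheb_C x (Suc m) = cheb_C b 2"
    unfolding b_def cheb_C_mult[symmetric] by (simp add: n)
  ultimately have b: "[cheb_C b 2 = x] (mod int p)"
    by (simp add: cong_iff_dvd_diff)
  have "cheb_C b m = cheb_C (cheb_C x m) (Suc n)"
    unfolding b_def cheb_C_mult[symmetric] by (simp only: mult.commute)
  then have "[cheb_C b m = 2] (mod int p)"
    using cheb_C_cong[OF Suc.prems(1), of "Suc n"] by (simp only: cheb_C_at_2)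
  then obtain a where "[cheb_C a (2 ^ s) = b] (mod int p)"
    using Suc.IH half_order_cheb_C(1)[OF b Suc.prems(2)] by blast
  then have "[cheb_C (cheb_C a (2 ^ s)) 2 = cheb_C b 2] (mod int p)"
    by (rule cheb_C_cong)
  then have "[cheb_C a (2 ^ Suc s) = x] (mod int p)"
    using b cong_trans by (fastforce simp: cheb_C_mult)
  then show ?case by blast
qed

section \<open>Images under 2-power maps and the 2-part of the half order\<close>

lemma not_dvd_minus: "\<not> int p dvd q ^ 2 - 4 \<Longrightarrow> \<not> int p dvd (- q) ^ 2 - 4"
  by simp

lemma half_order_decompose:
  obtains j m where "half_order p q = 2 ^ j * m" "odd m"
  using multiplicity_decompose'[of "half_order p q" 2] half_order_pos[of q]
  by (metis not_gr0 odd_one)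

text \<open>Otherwise the odd part m of the half order would annihilate both \<lambda> and
  -\<lambda>, although (-\<lambda>)^m = -\<lambda>^m; in traces, p would divide 4.\<close>

lemma image_both_dvd_half_order:
  assumes q: "\<not> int p dvd q ^ 2 - 4"
    and a: "[cheb_C a (2 ^ k) = q] (mod int p)" and b: "[cheb_C b (2 ^ k) = - q] (mod int p)"
  shows "2 ^ k dvd half_order p q"
proof (rule ccontr)
  assume ndvd: "\<not> 2 ^ k dvd half_order p q"
  obtain j m where jm: "half_order p q = 2 ^ j * m" "odd m"
    by (rule half_order_decompose)
  have "j < k"
    using ndvd jm(1) by (metis dvd_mult2 le_imp_power_dvd not_le)
  then have "2 ^ Suc j dvd (2::nat) ^ k"
    by (intro le_imp_power_dvd) simp
  then have dvd: "2 * half_order p q dvd m * 2 ^ k"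
    using jm(1) by (simp add: mult.commute mult.left_commute mult_dvd_mono)
  have "[cheb_C q m = 2] (mod int p)"
    by (rule cheb_C_eq_2_if_image[OF a q dvd])
  moreover have "[cheb_C (- q) m = 2] (mod int p)"
    using dvd by (intro cheb_C_eq_2_if_image[OF b not_dvd_minus[OF q]]) (simp add: half_order_minus)
  ultimately have "int p dvd (cheb_C q m - 2) + (cheb_C (- q) m - 2)"
    by (intro dvd_add) (simp_all add: cong_iff_dvd_diff)
  then show False
    using not_dvd_two_power[of 2] jm(2) by (simp add: cheb_C_minus)
qed

text \<open>If the half order is 2^k c, then \<lambda>^(2 c) = 1; the even exponent gives the same
  for -\<lambda>, and roots can be extracted.\<close>

lemma image_minus_if_dvd_half_order:
  assumes q: "\<not> int p dvd q ^ 2 - 4" and a: "[cheb_C a (2 ^ k) = q] (mod int p)"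
    and dvd: "2 ^ k dvd half_order p q"
  shows "\<exists>b. [cheb_C b (2 ^ k) = - q] (mod int p)"
proof -
  from dvd obtain c where c: "half_order p q = 2 ^ k * c" by (rule dvdE)
  have "[cheb_C q (2 * c) = 2] (mod int p)"
    by (rule cheb_C_eq_2_if_image[OF a q]) (simp add: c)
  then have "[cheb_C (- q) (2 * c) = 2] (mod int p)"
    by (simp add: cheb_C_minus)
  then show ?thesis
    by (intro image_if_cheb_C_eq_2[where m = "2 * c"] not_dvd_minus[OF q])
       (simp_all add: half_order_minus c)
qed

lemma cheb_C_eq_2_or_minus_2:
  assumes "[cheb_C q (2 * n) = 2] (mod int p)"
  shows "[cheb_C q n = 2] (mod int p) \<or> [cheb_C q n = - 2] (mod int p)"
proof -
  have "cheb_C q (2 * n) - 2 = (cheb_C q n - 2) * (cheb_C q n + 2)"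
    unfolding cheb_C_double by (simp add: algebra_simps power2_eq_square)
  then have "int p dvd (cheb_C q n - 2) * (cheb_C q n + 2)"
    using assms by (simp add: cong_iff_dvd_diff)
  then show ?thesis
    using prime_int by (simp add: cong_iff_dvd_diff prime_dvd_mult_iff)
qed

text \<open>For odd m, \<lambda>^m = -1 means (-\<lambda>)^m = 1, so \<lambda> or -\<lambda> has odd
  order.\<close>

lemma image_if_cheb_C_odd_eq_2_or_minus_2:
  assumes m: "odd m" and c: "[cheb_C q m = 2] (mod int p) \<or> [cheb_C q m = - 2] (mod int p)"
    and q: "\<not> int p dvd q ^ 2 - 4"
  shows "(\<exists>a. [cheb_C a (2 ^ s) = q] (mod int p)) \<or> (\<exists>a. [cheb_C a (2 ^ s) = - q] (mod int p))"
  using c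
proof
  assume "[cheb_C q m = - 2] (mod int p)"
  then have "[cheb_C (- q) m = 2] (mod int p)"
    using m cong_minus_minus_iff[of "cheb_C q m" "- 2" "int p"] by (simp add: cheb_C_minus)
  then show ?thesis
    using image_if_cheb_C_odd_eq_2[OF m _ not_dvd_minus[OF q]] by blast
qed (use image_if_cheb_C_odd_eq_2[OF m _ q] in blast)

text \<open>Otherwise the half order is 2^k m with m odd. As \<lambda> is a 2^k-th power,
  \<lambda>^(2 m) = 1, so \<lambda>^m is 1 or -1 and \<lambda> or -\<lambda> would have the excluded
  root.\<close>

lemma dvd_half_order_if_not_image:
  assumes q: "\<not> int p dvd q ^ 2 - 4" and a: "[cheb_C a (2 ^ k) = q] (mod int p)"
    and dvd: "2 ^ k dvd half_order p q"
    and not_image: "\<not> (\<exists>a. [cheb_C a (2 ^ Suc k) = q] (mod int p))"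
      "\<not> (\<exists>a. [cheb_C a (2 ^ Suc k) = - q] (mod int p))"
  shows "2 ^ Suc k dvd half_order p q"
proof (rule ccontr)
  assume ndvd: "\<not> 2 ^ Suc k dvd half_order p q"
  from dvd obtain m where m: "half_order p q = 2 ^ k * m" by (rule dvdE)
  with ndvd have "odd m" by (auto simp: mult.commute)
  have "[cheb_C q (2 * m) = 2] (mod int p)"
    by (rule cheb_C_eq_2_if_image[OF a q]) (simp add: m)
  from image_if_cheb_C_odd_eq_2_or_minus_2[OF \<open>odd m\<close> cheb_C_eq_2_or_minus_2[OF this] q]
  show False using not_image by blast
qed

text \<open>The values of \<open>C\<close> at \<open>2\<^sup>j m\<close> end in 2; stepping back, the first \<open>\<plusminus>2\<close> reached is \<open>-2\<close>,
  and it is preceded by a zero.\<close>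

lemma cheb_C_zero_if_not_image:
  assumes q: "\<not> int p dvd q ^ 2 - 4"
    and not_image: "\<not> (\<exists>a. [cheb_C a (2 ^ s) = q] (mod int p))"
      "\<not> (\<exists>a. [cheb_C a (2 ^ s) = - q] (mod int p))"
  obtains j m where "odd m" "[cheb_C q (2 ^ j * m) = 0] (mod int p)"
proof -
  obtain i m where im: "half_order p q = 2 ^ i * m" "odd m"
    by (rule half_order_decompose)
  let ?P = "\<lambda>j. [cheb_C q (2 ^ j * m) = 2] (mod int p) \<or> [cheb_C q (2 ^ j * m) = - 2] (mod int p)"
  have P0: "\<not> ?P 0"
    using image_if_cheb_C_odd_eq_2_or_minus_2[OF im(2) _ q, of s] not_image by auto
  have "[cheb_C q (2 ^ Suc i * m) = 2] (mod int p)"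
    by (rule cheb_C_order[OF q]) (simp add: im(1))
  then have "?P (Suc i)" by blast
  then obtain j where j: "?P (Suc j)" "\<not> ?P j"
    using P0 ex_least_nat_less[of ?P "Suc i"] by blast
  have "cheb_C q (2 ^ Suc j * m) = cheb_C q (2 * (2 ^ j * m))"
    by (simp add: mult.assoc)
  \<comment> \<open>The value 2 at \<open>Suc j\<close> would give \<open>?P j\<close>, so the value
    there is -2.\<close>
  with j cheb_C_eq_2_or_minus_2[of q "2 ^ j * m"]
  have "[cheb_C q (2 ^ j * m) ^ 2 - 2 = - 2] (mod int p)"
    by (metis cheb_C_double)
  then have "int p dvd cheb_C q (2 ^ j * m) ^ 2"
    by (simp add: cong_iff_dvd_diff)
  then have "[cheb_C q (2 ^ j * m) = 0] (mod int p)"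
    using prime_int by (simp add: cong_0_iff prime_dvd_power_iff)
  with im(2) show thesis by (rule that)
qed

text \<open>The group order is 2^(k+1) m, so a 2^(k+1)-th power satisfies \<lambda>^m = 1; the
  factor q - 2 of \<open>cheb_C q m - 2\<close> is nonzero modulo p.\<close>

lemma cheb_W_zero_if_image:
  assumes q: "\<not> int p dvd q ^ 2 - 4" and a: "[cheb_C a (2 ^ Suc k) = q] (mod int p)"
    and m: "half_order p q = 2 ^ k * m" "odd m"
  shows "[cheb_W q m = 0] (mod int p)"
proof -
  have "[cheb_C q m = 2] (mod int p)"
    by (rule cheb_C_eq_2_if_image[OF a q]) (simp add: m(1))
  then have "int p dvd (q - 2) * cheb_W q m ^ 2"
    using m(2) by (simp add: cheb_C_odd_minus_2[symmetric] cong_iff_dvd_diff)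
  moreover have "\<not> int p dvd q - 2"
    using q dvd_mult2[of "int p" "q - 2" "q + 2"] by (auto simp: algebra_simps power2_eq_square)
  ultimately show ?thesis
    using prime_int prime_dvd_power by (auto simp: cong_0_iff prime_dvd_mult_iff prime_dvd_power_iff)
qed

lemma cheb_V_zero_if_image:
  assumes q: "\<not> int p dvd q ^ 2 - 4" and a: "[cheb_C a (2 ^ Suc k) = - q] (mod int p)"
    and m: "half_order p q = 2 ^ k * m" "odd m"
  shows "[cheb_V q m = 0] (mod int p)"
proof -
  from m(2) obtain r where r: "m = 2 * r + 1" by (rule oddE)
  have "[cheb_W (- q) m = 0] (mod int p)"
    using cheb_W_zero_if_image[OF not_dvd_minus[OF q] a] m by (simp add: half_order_minus)
  moreover have "cheb_V q m = (-1) ^ r * cheb_W (- q) m"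
    using cheb_V_minus[of "- q" r] by (simp add: r)
  ultimately show ?thesis by (simp add: cong_0_iff)
qed

end

section \<open>Residues of rationals represented by integers\<close>

text \<open>The residue of \<open>x\<close> modulo \<open>p\<close> is represented by the integer \<open>i\<close>.\<close>

definition rat_rep :: "nat \<Rightarrow> rat \<Rightarrow> int \<Rightarrow> bool" where
  "rat_rep p x i \<longleftrightarrow> (\<exists>m n. \<not> int p dvd n \<and> x = of_int i + of_int (int p * m) / of_int n)"

lemma rat_rep_of_int: "prime p \<Longrightarrow> rat_rep p (of_int i) i"
  unfolding rat_rep_def by (rule exI[of _ 0], rule exI[of _ 1]) auto

lemma rat_rep_minus: "rat_rep p x i \<Longrightarrow> rat_rep p (- x) (- i)"
  unfolding rat_rep_def
proof (elim exE conjE)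
  fix m n
  assume "\<not> int p dvd n" "x = of_int i + of_int (int p * m) / of_int n"
  then show "\<exists>m n. \<not> int p dvd n \<and> - x = of_int (- i) + of_int (int p * m) / of_int n"
    by (intro exI[of _ "- m"] exI[of _ n]) simp
qed

lemma rat_rep_add:
  assumes "prime p" "rat_rep p x i" "rat_rep p y j"
  shows "rat_rep p (x + y) (i + j)"
proof -
  from assms obtain m n m' n' where
    n: "\<not> int p dvd n" "x = of_int i + of_int (int p * m) / of_int n" and
    n': "\<not> int p dvd n'" "y = of_int j + of_int (int p * m') / of_int n'"
    unfolding rat_rep_def by blast
  have "n \<noteq> 0" "n' \<noteq> 0" using n n' by auto
  then have "x + y = of_int (i + j) + of_int (int p * (m * n' + m' * n)) / of_int (n * n')"
    by (simp add: n n' field_simps)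
  moreover have "\<not> int p dvd n * n'"
    using assms(1) n n' by (simp add: prime_dvd_mult_iff)
  ultimately show ?thesis unfolding rat_rep_def by blast
qed

lemma rat_rep_diff:
  assumes "prime p" "rat_rep p x i" "rat_rep p y j"
  shows "rat_rep p (x - y) (i - j)"
  using rat_rep_add[OF assms(1,2) rat_rep_minus[OF assms(3)]] by simp

lemma rat_rep_mult:
  assumes "prime p" "rat_rep p x i" "rat_rep p y j"
  shows "rat_rep p (x * y) (i * j)"
proof -
  from assms obtain m n m' n' where
    n: "\<not> int p dvd n" "x = of_int i + of_int (int p * m) / of_int n" and
    n': "\<not> int p dvd n'" "y = of_int j + of_int (int p * m') / of_int n'"
    unfolding rat_rep_def by blast
  have "n \<noteq> 0" "n' \<noteq> 0" using n n' by auto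
  then have "x * y = of_int (i * j) +
      of_int (int p * (i * m' * n + j * m * n' + int p * m * m')) / of_int (n * n')"
    by (simp add: n n' field_simps)
  moreover have "\<not> int p dvd n * n'"
    using assms(1) n n' by (simp add: prime_dvd_mult_iff)
  ultimately show ?thesis unfolding rat_rep_def by blast
qed

lemma rat_eq_numer_div_denom: "x = of_int (rat_numer x) / of_int (rat_denom x)"
  unfolding rat_numer_def rat_denom_def by (rule quotient_of_div) simp

lemma rat_denom_nonzero: "rat_denom x \<noteq> 0"
  unfolding rat_denom_def using quotient_of_denom_pos'[of x] by simp

lemma coprime_rat_numer_denom: "coprime (rat_numer x) (rat_denom x)"
  unfolding rat_numer_def rat_denom_def by (rule quotient_of_coprime) simp

lemma rat_rep_exists:
  assumes p: "prime p" and d: "\<not> int p dvd rat_denom x"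
  obtains i where "rat_rep p x i"
proof -
  let ?a = "rat_numer x" and ?b = "rat_denom x"
  have "coprime ?b (int p)"
    using p d by (metis coprime_commute prime_imp_coprime prime_nat_int_transfer)
  then obtain c where "[?b * c = 1] (mod int p)"
    using cong_solve_coprime_int by blast
  then obtain e where "1 - ?b * c = int p * e"
    by (metis cong_iff_dvd_diff cong_sym dvdE)
  then have e: "?a = ?a * c * ?b + int p * (e * ?a)"
    by (metis (no_types, opaque_lifting) add_diff_cancel_left' add_diff_eq diff_add_cancel
        distrib_left mult.assoc mult.commute mult.right_neutral)
  have "x = of_int ?a / of_int ?b" by (rule rat_eq_numer_div_denom)
  also have "\<dots> = of_int (?a * c) + of_int (int p * (e * ?a)) / of_int ?b"
    using rat_denom_nonzero[of x] by (subst e) (simp add: field_simps)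
  finally have "rat_rep p x (?a * c)" unfolding rat_rep_def using d by blast
  then show thesis by (rule that)
qed

text \<open>The denominator n in \<open>rat_rep\<close> need not be the reduced one. After
  cross-multiplying, a factor p of the reduced denominator would divide the numerator too, against
  coprimality.\<close>

lemma rat_rep_numer_denom:
  assumes p: "prime p" and "rat_rep p x i"
  shows "\<not> int p dvd rat_denom x" "[rat_numer x = i * rat_denom x] (mod int p)"
proof -
  let ?a = "rat_numer x" and ?b = "rat_denom x"
  from assms obtain m n where n: "\<not> int p dvd n" "x = of_int i + of_int (int p * m) / of_int n"
    unfolding rat_rep_def by blast
  have "n \<noteq> 0" using n by auto
  with n(2) have "of_int (?a * n) = (of_int (?b * (i * n + int p * m)) :: rat)"
    using rat_denom_nonzero[of x]
    by (subst (asm) rat_eq_numer_div_denom[of x]) (simp add: field_simps)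
  then have eq: "?a * n = ?b * (i * n + int p * m)"
    by (simp only: of_int_eq_iff)
  have pi: "prime (int p)" using p by simp
  show "\<not> int p dvd ?b"
  proof
    assume b: "int p dvd ?b"
    then have "int p dvd ?a * n" unfolding eq by simp
    then have "int p dvd ?a" using n(1) pi prime_dvd_mult_iff by blast
    with b coprime_rat_numer_denom[of x] pi show False
      by (meson coprime_common_divisor not_prime_unit)
  qed
  have "(?a - i * ?b) * n = int p * (?b * m)"
    using eq by (simp add: algebra_simps)
  then have "int p dvd (?a - i * ?b) * n" by simp
  then show "[?a = i * ?b] (mod int p)"
    using n(1) pi prime_dvd_mult_iff cong_iff_dvd_diff by blast
qed

lemma rat_cong_iff_rat_rep:
  assumes p: "prime p" and x: "rat_rep p x i" and y: "rat_rep p y j"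
  shows "rat_cong p x y \<longleftrightarrow> [i = j] (mod int p)"
proof -
  note z = rat_rep_numer_denom[OF p rat_rep_diff[OF p x y]]
  have "int p dvd rat_numer (x - y) \<longleftrightarrow> int p dvd (i - j) * rat_denom (x - y)"
    using z(2) by (rule cong_dvd_iff)
  also have "\<dots> \<longleftrightarrow> int p dvd i - j"
    using z(1) p by (simp add: prime_dvd_mult_iff)
  finally show ?thesis
    using rat_rep_numer_denom(1)[OF p x] rat_rep_numer_denom(1)[OF p y]
    by (simp add: rat_cong_def cong_iff_dvd_diff)
qed

lemma rat_rep_cheb_U:
  assumes "prime p" "rat_rep p x i"
  shows "rat_rep p (cheb_U x n) (cheb_U i n)"
proof (induction n rule: induct_nat_012)
  case (ge2 n)
  then show ?case using assms by (simp add: rat_rep_diff rat_rep_mult)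
qed (use rat_rep_of_int[OF assms(1), of 0] rat_rep_of_int[OF assms(1), of 1] in simp_all)

lemma rat_rep_cheb_C:
  assumes "prime p" "rat_rep p x i"
  shows "rat_rep p (cheb_C x n) (cheb_C i n)"
  unfolding cheb_C_eq_U using rat_rep_of_int[OF assms(1), of 2]
  by (intro rat_rep_diff rat_rep_mult rat_rep_cheb_U assms) simp

lemma rat_rep_disc:
  assumes "prime p" "rat_rep p x i"
  shows "rat_rep p (disc x) (i ^ 2 - 4)"
  unfolding disc_def power2_eq_square using rat_rep_of_int[OF assms(1), of 4]
  by (intro rat_rep_diff rat_rep_mult assms) simp

text \<open>The classes \<open>Pi_class\<close> need p prime to the denominator of x, while
  \<open>Pi_prime\<close> speaks of its discriminant. Clearing denominators in x^2 - 4, a p dividing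
  the denominator of x would divide its numerator.\<close>

lemma Pi_prime_not_dvd_denom:
  assumes "p \<in> Pi_prime x"
  shows "\<not> int p dvd rat_denom x"
proof
  let ?a = "rat_numer x" and ?b = "rat_denom x"
  let ?d = "disc x"
  assume b: "int p dvd ?b"
  from assms have p: "prime (int p)" and nd: "\<not> int p dvd rat_denom ?d"
    by (auto simp: Pi_prime_def)
  have "of_int (rat_numer ?d) / of_int (rat_denom ?d) = ?d"
    by (rule rat_eq_numer_div_denom[symmetric])
  also have "?d = (of_int ?a / of_int ?b) ^ 2 - 4"
    unfolding disc_def using rat_eq_numer_div_denom[of x] by simp
  finally have "of_int (rat_numer ?d * ?b ^ 2) = (of_int (rat_denom ?d * (?a ^ 2 - 4 * ?b ^ 2)) :: rat)"
    using rat_denom_nonzero[of x] rat_denom_nonzero[of ?d]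
    by (simp add: field_simps power2_eq_square)
  then have "rat_numer ?d * ?b ^ 2 = rat_denom ?d * (?a ^ 2 - 4 * ?b ^ 2)"
    by (simp only: of_int_eq_iff)
  moreover have b2: "int p dvd ?b ^ 2" using b by (simp add: power2_eq_square)
  ultimately have "int p dvd rat_denom ?d * (?a ^ 2 - 4 * ?b ^ 2)"
    by (metis dvd_mult)
  then have "int p dvd ?a ^ 2 - 4 * ?b ^ 2"
    using nd p prime_dvd_mult_iff by blast
  then have "int p dvd ?a ^ 2" using b2
    by (metis diff_add_cancel dvd_add dvd_mult)
  then have "int p dvd ?a" using p prime_dvd_power by blast
  with b coprime_rat_numer_denom[of x] p show False
    by (meson coprime_common_divisor not_prime_unit)
qed

text \<open>Numerator times denominator of the discriminant is its residue times a nonzero square,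
  so \<open>p_hat\<close> and \<open>half_order\<close> use the same symbol.\<close>

lemma Pi_primeD:
  assumes "p \<in> Pi_prime x" "rat_rep p x i"
  shows "prime p" "odd p" "\<not> int p dvd i ^ 2 - 4" "p_hat x p = int (half_order p i)"
proof -
  show p: "prime p" "odd p" using assms by (auto simp: Pi_prime_def)
  let ?n = "rat_numer (disc x)" and ?d = "rat_denom (disc x)"
  note rep = rat_rep_numer_denom[OF p(1) rat_rep_disc[OF p(1) assms(2)]]
  have "\<not> int p dvd ?n" using assms by (simp add: Pi_prime_def)
  with rep(2) show "\<not> int p dvd i ^ 2 - 4" by (meson cong_dvd_iff dvd_mult2)
  have "[?n * ?d = (i ^ 2 - 4) * ?d ^ 2] (mod int p)"
    using cong_mult[OF rep(2) cong_refl[of ?d]] by (simp add: power2_eq_square mult.assoc)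
  then have "rat_Legendre (disc x) p = Legendre ((i ^ 2 - 4) * ?d ^ 2) (int p)"
    unfolding rat_Legendre_def by (rule Legendre_cong)
  also have "\<dots> = Legendre (i ^ 2 - 4) (int p)"
    by (rule Legendre_mult_square[OF p rep(1)])
  finally have "p_hat x p = (int p - Legendre (i ^ 2 - 4) (int p)) div 2"
    by (simp add: p_hat_def)
  moreover have "\<dots> \<ge> 0"
    using prime_gt_1_nat[OF p(1)] by (auto simp: Legendre_def)
  ultimately show "p_hat x p = int (half_order p i)"
    by (simp add: half_order_def)
qed

section \<open>The Omega and Pi sets in terms of integer congruences\<close>

lemma
  assumes rep: "rat_rep p q0 q"
  shows mem_Omega_plus_iff: "p \<in> Omega_plus q0 s \<longleftrightarrow>
      p \<in> Pi_prime q0 \<and> (\<exists>a. [cheb_C a (2 ^ s) = q] (mod int p))"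
    and mem_Omega_minus_iff: "p \<in> Omega_minus q0 s \<longleftrightarrow>
      p \<in> Pi_prime q0 \<and> (\<exists>a. [cheb_C a (2 ^ s) = - q] (mod int p))"
proof -
  have prime: "prime p" if "p \<in> Pi_prime q0" using that by (simp add: Pi_prime_def)
  \<comment> \<open>\<open>cheb_C a 1\<close> is a, so the convention for s = 0 agrees with the
    general condition.\<close>
  have "\<exists>a. [cheb_C a (2 ^ 0) = x] (mod int p)" for x
    by (auto intro!: exI[of _ x])
  then show
    "p \<in> Omega_plus q0 s \<longleftrightarrow> p \<in> Pi_prime q0 \<and> (\<exists>a. [cheb_C a (2 ^ s) = q] (mod int p))"
    "p \<in> Omega_minus q0 s \<longleftrightarrow> p \<in> Pi_prime q0 \<and> (\<exists>a. [cheb_C a (2 ^ s) = - q] (mod int p))"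
    using prime rat_cong_iff_rat_rep[OF _ rat_rep_of_int rep]
      rat_cong_iff_rat_rep[OF _ rat_rep_of_int rat_rep_minus[OF rep]]
    unfolding Omega_plus_def Omega_minus_def by (cases s; auto)+
qed

lemma
  assumes "p \<in> Pi_prime q0" and rep: "rat_rep p q0 q"
  shows Pi_class_0I: "odd n \<Longrightarrow> [cheb_W q n = 0] (mod int p) \<Longrightarrow> p \<in> Pi_class 0 q0"
    and Pi_class_1I: "odd n \<Longrightarrow> [cheb_V q n = 0] (mod int p) \<Longrightarrow> p \<in> Pi_class 1 q0"
    and Pi_starI: "odd n \<Longrightarrow> [cheb_C q (2 ^ j * n) = 0] (mod int p) \<Longrightarrow> p \<in> Pi_star q0"
proof -
  have p: "prime p" and good: "odd_good_prime q0 p"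
    using assms(1) Pi_prime_not_dvd_denom[OF assms(1)]
    by (auto simp: Pi_prime_def odd_good_prime_def)
  have zero: "rat_rep p 0 0" using rat_rep_of_int[OF p, of 0] by simp
  note cong0 = rat_cong_iff_rat_rep[OF p _ zero]
  show "p \<in> Pi_class 0 q0" if n: "odd n" "[cheb_W q n = 0] (mod int p)"
  proof -
    have "rat_rep p (cheb_W q0 n) (cheb_W q n)"
      unfolding cheb_W_def by (intro rat_rep_add rat_rep_cheb_U p rep)
    then show ?thesis using n good by (auto simp: cong0)
  qed
  show "p \<in> Pi_class 1 q0" if n: "odd n" "[cheb_V q n = 0] (mod int p)"
  proof -
    have "rat_rep p (cheb_V q0 n) (cheb_V q n)"
      unfolding cheb_V_def by (intro rat_rep_diff rat_rep_cheb_U p rep)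
    then show ?thesis using n good by (auto simp: cong0)
  qed
  show "p \<in> Pi_star q0" if n: "odd n" "[cheb_C q (2 ^ j * n) = 0] (mod int p)"
  proof -
    have "p \<in> Pi_class (Suc (Suc j)) q0"
      using n good cong0[OF rat_rep_cheb_C[OF p rep]] by auto
    then show ?thesis unfolding Pi_star_def by (intro UN_I[of "Suc (Suc j)"]) simp_all
  qed
qed

theorem theorem13:
  fixes q0 :: rat and k :: nat
  assumes "\<not> (\<exists>r::rat. 2 + q0 = r ^ 2)"
    and "\<not> (\<exists>r::rat. 2 - q0 = r ^ 2)"
    and "k \<ge> 1"
  shows "((Omega_plus q0 k - Omega_minus q0 k) \<inter> R_set q0 (k - 1)
            \<subseteq> Pi_class 0 q0 \<inter> {p \<in> Pi_prime q0. exactly_divides (k - 1) (p_hat q0 p)})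
       \<and> ((Omega_minus q0 k - Omega_plus q0 k) \<inter> R_set q0 (k - 1)
            \<subseteq> Pi_class 1 q0 \<inter> {p \<in> Pi_prime q0. exactly_divides (k - 1) (p_hat q0 p)})
       \<and> (Z_set q0 k \<subseteq> Pi_star q0 \<inter> {p \<in> Pi_prime q0. 2 ^ k dvd p_hat q0 p})
       \<and> (R_set q0 k \<subseteq> {p \<in> Pi_prime q0. 2 ^ k dvd p_hat q0 p})"
proof -
  from \<open>k \<ge> 1\<close> obtain l where k: "k = Suc l" by (cases k) auto
  \<comment> \<open>All sets on the left lie in \<open>Pi_prime q0\<close>, so one prime p and an
    integer residue q of q0 can be fixed.\<close>
  have pointwise:
    "(p \<in> Omega_plus q0 k \<longrightarrow> p \<notin> Omega_minus q0 k \<longrightarrow> p \<in> R_set q0 l \<longrightarrow>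
       p \<in> Pi_class 0 q0 \<and> exactly_divides l (p_hat q0 p)) \<and>
     (p \<in> Omega_minus q0 k \<longrightarrow> p \<notin> Omega_plus q0 k \<longrightarrow> p \<in> R_set q0 l \<longrightarrow>
       p \<in> Pi_class 1 q0 \<and> exactly_divides l (p_hat q0 p)) \<and>
     (p \<in> R_set q0 l \<longrightarrow> p \<notin> Omega_plus q0 k \<longrightarrow> p \<notin> Omega_minus q0 k \<longrightarrow>
       p \<in> Pi_star q0 \<and> 2 ^ k dvd p_hat q0 p) \<and>
     (p \<in> R_set q0 k \<longrightarrow> 2 ^ k dvd p_hat q0 p)"
    if Pi: "p \<in> Pi_prime q0" for p
  proof -
    have "prime p" using Pi by (simp add: Pi_prime_def)
    then obtain q where rep: "rat_rep p q0 q"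
      using rat_rep_exists Pi_prime_not_dvd_denom[OF Pi] by blast
    note p = Pi_primeD[OF Pi rep]
    let ?h = "half_order p q"
    let ?P = "\<lambda>s x. \<exists>a. [cheb_C a (2 ^ s) = x] (mod int p)"
    have plus: "p \<in> Omega_plus q0 s \<longleftrightarrow> ?P s q" for s
      using mem_Omega_plus_iff[OF rep] Pi by blast
    have minus: "p \<in> Omega_minus q0 s \<longleftrightarrow> ?P s (- q)" for s
      using mem_Omega_minus_iff[OF rep] Pi by blast
    have R: "p \<in> R_set q0 s \<longleftrightarrow> ?P s q \<and> ?P s (- q)" for s
      by (simp add: R_set_def plus minus)
    have dvd: "2 ^ s dvd p_hat q0 p \<longleftrightarrow> 2 ^ s dvd ?h" for s
      unfolding p(4) by (metis int_dvd_int_iff of_nat_numeral of_nat_power)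
    have both: "2 ^ s dvd ?h" if "?P s q" "?P s (- q)" for s
      using that image_both_dvd_half_order[OF p(1-3)] by blast
    have minusI: "?P s (- q)" if "?P s q" "2 ^ s dvd ?h" for s
      using that image_minus_if_dvd_half_order[OF p(1-3)] by blast
    have plusI: "?P s q" if "?P s (- q)" "2 ^ s dvd ?h" for s
      using that image_minus_if_dvd_half_order[OF p(1,2) not_dvd_minus[OF p(1-3)], of _ s]
      by (auto simp: half_order_minus[of p])
    have odd_part: "\<exists>m. ?h = 2 ^ l * m \<and> odd m" if "2 ^ l dvd ?h" "\<not> 2 ^ k dvd ?h"
      using that by (auto simp: k elim!: dvdE)
    have "p \<in> Pi_class 0 q0 \<and> exactly_divides l (p_hat q0 p)"
      if "?P k q" "\<not> ?P k (- q)" "?P l q" "?P l (- q)"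
    proof -
      \<comment> \<open>Both signs at level l give 2^l; divisibility by 2^k would put -q into the
        image at level k as well.\<close>
      have e: "2 ^ l dvd ?h" "\<not> 2 ^ k dvd ?h"
        using that both minusI by blast+
      from odd_part[OF e] obtain m where "?h = 2 ^ l * m" "odd m" by blast
      then have "p \<in> Pi_class 0 q0"
        using Pi_class_0I[OF Pi rep] cheb_W_zero_if_image[OF p(1-3)] that(1) k by blast
      with e show ?thesis
        by (simp only: exactly_divides_def dvd k Suc_eq_plus1) simp
    qed
    moreover have "p \<in> Pi_class 1 q0 \<and> exactly_divides l (p_hat q0 p)"
      if "?P k (- q)" "\<not> ?P k q" "?P l q" "?P l (- q)"
    proof -
      have e: "2 ^ l dvd ?h" "\<not> 2 ^ k dvd ?h"
        using that both plusI by blast+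
      from odd_part[OF e] obtain m where "?h = 2 ^ l * m" "odd m" by blast
      then have "p \<in> Pi_class 1 q0"
        using Pi_class_1I[OF Pi rep] cheb_V_zero_if_image[OF p(1-3)] that(1) k by blast
      with e show ?thesis
        by (simp only: exactly_divides_def dvd k Suc_eq_plus1) simp
    qed
    moreover have "p \<in> Pi_star q0 \<and> 2 ^ k dvd ?h"
      if "\<not> ?P k q" "\<not> ?P k (- q)" "?P l q" "?P l (- q)"
    proof
      show "p \<in> Pi_star q0"
        using cheb_C_zero_if_not_image[OF p(1-3) that(1,2)] Pi_starI[OF Pi rep] by blast
      show "2 ^ k dvd ?h"
        using dvd_half_order_if_not_image[OF p(1-3)] that both unfolding k by blast
    qed
    moreover note both
    ultimately show ?thesis unfolding plus minus R dvd by blast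
  qed
  have "Omega_plus q0 s \<subseteq> Pi_prime q0" "Omega_minus q0 s \<subseteq> Pi_prime q0" "R_set q0 s \<subseteq> Pi_prime q0" for s
    by (auto simp: Omega_plus_def Omega_minus_def R_set_def split: if_splits)
  with pointwise show ?thesis
    unfolding Z_set_def k diff_Suc_1 by (intro conjI subsetI) blast+
qed

end
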